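(* Let $f(x)=e^{-x}$ and let $\mathbf R(y,z)=(e^{z},\,e^{z}-y)$ be the variational recursion in $(y,z)$ coordinates. Suppose that the region above the separatrix supports a consistent cone field $K$ with generators $\eta,\xi$, where $\eta$ is not $\mathbf R$-invariant. Let $I=(y_-,y_+)\subset(0,\infty)$ be any open interval such that $(t,t)\in\mathcal M_\infty$ for all $t\in I$ (i.e. $I$, regarded as a subset of the ray of initial data $\{(t,t):t>0\}$, lies in the monotone region). Then the cost function $x\mapsto E(x)$ is monotone on $I$.
   Context: Setting (one-sided linear search, exponential law): $f(x)=\mathbb P(\mathbf H>x)=e^{-x}$. For $x>0$ let $x_0=0$, $x_1=x$, and $x_{n+1}=-f(x_{n-1})/f'(x_n)=e^{x_n-x_{n-1}}$ for $n\ge1$ (the variational recursion). The cost function is $E(x)=\sum_{k=0}^\infty x_{k+1}f(x_k)$ along this sequence. Coordinates: $(y,z)=(x_{k+1},x_{k+1}-x_k)$; in these coordinates $\mathbf R(y,z)=(e^z,e^z-y)$, and the initial data $x_0=0$, $x_1=t$ is the point $(t,t)$. The phase space is $\mathcal P=\{(y,z): y\ge 0,\ y-z\ge 0\}$. The monotone region $\mathcal M_\infty\subset\mathcal P$ is the set of points $p\in\mathcal P$ such that the $y$-coordinates of $p,\mathbf R(p),\mathbf R^2(p),\dots$ form a strictly increasing sequence. The separatrix is the boundary of $\mathcal M_\infty$ relative to $\mathcal P$; the region above the separatrix is the interior of $\mathcal M_\infty$ relative to $\mathcal P$. A cone field on a region is a pair of nowhere collinear vector fields $\eta,\xi$ (the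 generators) on it, together with the convex cones $K_p=\{a\eta(p)+b\xi(p):a,b\ge0\}$ in the tangent spaces. It is consistent if $D\mathbf R_p(K_p)\subset K_{\mathbf R(p)}$ for all $p$ in the region, where $D\mathbf R$ is the differential of $\mathbf R$. A vector field $\eta$ is $\mathbf R$-invariant if $D\mathbf R_p\,\eta(p)$ is proportional to $\eta(\mathbf R(p))$ for every $p$. *)

theory Defs
  imports "HOL-Analysis.Analysis"
begin

fun var_seq :: "(real \<Rightarrow> real) \<Rightarrow> real \<Rightarrow> nat \<Rightarrow> real" where
  "var_seq f x 0 = 0"
| "var_seq f x (Suc 0) = x"
| "var_seq f x (Suc (Suc n)) = - f (var_seq f x n) / deriv f (var_seq f x (Suc n))"

text \<open>The cost is \<open>[0, \<infinity>]\<close>-valued so that a divergent series has cost \<open>\<infinity>\<close>.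
  Nothing is truncated by \<open>ennreal\<close> for the exponential law: its turning points are nonnegative
  when \<open>x > 0\<close> (see \<open>var_seq_exp_nonneg\<close> below).\<close>

definition cost :: "(real \<Rightarrow> real) \<Rightarrow> real \<Rightarrow> ennreal" where
  "cost f x = (\<Sum>k. ennreal (var_seq f x (Suc k) * f (var_seq f x k)))"

definition var_map :: "real \<times> real \<Rightarrow> real \<times> real" where
  "var_map = (\<lambda>(y, z). (exp z, exp z - y))"

definition phase_space :: "(real \<times> real) set" where
  "phase_space = {(y, z). y \<ge> 0 \<and> y - z \<ge> 0}"

definition monotone_region :: "(real \<times> real) set" where
  "monotone_region = {p \<in> phase_space. strict_mono (\<lambda>n. fst ((var_map ^^ n) p))}"

definition separatrix :: "(real \<times> real) set" where
  "separatrix = top_of_set phase_space frontier_of monotone_region"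

definition above_separatrix :: "(real \<times> real) set" where
  "above_separatrix = top_of_set phase_space interior_of monotone_region"

text \<open>All tangent spaces are identified with \<open>real \<times> real\<close>, and a vector field on a
  region is a function of which only the values on that region matter. No regularity of the
  generators is required.\<close>

definition cone :: "('a \<Rightarrow> 'b) \<Rightarrow> ('a \<Rightarrow> 'b) \<Rightarrow> 'a \<Rightarrow> 'b::real_vector set" where
  "cone \<eta> \<xi> p = {a *\<^sub>R \<eta> p + b *\<^sub>R \<xi> p | a b. a \<ge> 0 \<and> b \<ge> 0}"

definition cone_field_on ::
    "'a set \<Rightarrow> ('a \<Rightarrow> 'b::real_vector) \<Rightarrow> ('a \<Rightarrow> 'b) \<Rightarrow> bool" where
  "cone_field_on U \<eta> \<xi> \<longleftrightarrow> (\<forall>p\<in>U. \<not> collinear {0, \<eta> p, \<xi> p})"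

definition consistent_on ::
    "'a set \<Rightarrow> ('a \<Rightarrow> 'a) \<Rightarrow> ('a \<Rightarrow> 'a) \<Rightarrow> ('a \<Rightarrow> 'a::real_normed_vector) \<Rightarrow> bool" where
  "consistent_on U F \<eta> \<xi> \<longleftrightarrow>
     (\<forall>p\<in>U. frechet_derivative F (at p) ` cone \<eta> \<xi> p \<subseteq> cone \<eta> \<xi> (F p))"

definition invariant_field_on ::
    "'a set \<Rightarrow> ('a \<Rightarrow> 'a) \<Rightarrow> ('a \<Rightarrow> 'a::real_normed_vector) \<Rightarrow> bool" where
  "invariant_field_on U F \<eta> \<longleftrightarrow>
     (\<forall>p\<in>U. \<exists>c. frechet_derivative F (at p) (\<eta> p) = c *\<^sub>R \<eta> (F p))"

lemma var_seq_exp_Suc_Suc: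
  "var_seq (\<lambda>x. exp (- x)) x (Suc (Suc n)) =
     exp (var_seq (\<lambda>x. exp (- x)) x (Suc n) - var_seq (\<lambda>x. exp (- x)) x n)"
proof -
  have "deriv (\<lambda>x. exp (- x)) u = - exp (- u)" for u :: real
    by (rule DERIV_imp_deriv) (auto intro!: derivative_eq_intros)
  then show ?thesis
    by (simp only: var_seq.simps) (simp add: exp_diff exp_minus field_simps)
qed

lemma var_seq_exp_nonneg:
  assumes "x > 0"
  shows "var_seq (\<lambda>x. exp (- x)) x n \<ge> 0"
proof (cases n)
  case (Suc m)
  then show ?thesis
    using assms by (cases m) (auto simp del: var_seq.simps(3) simp: var_seq_exp_Suc_Suc)
qed simp

lemma var_map_iterates_initial_ray:
  "(var_map ^^ n) (t, t) =
     (var_seq (\<lambda>x. exp (- x)) t (Suc n),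
      var_seq (\<lambda>x. exp (- x)) t (Suc n) - var_seq (\<lambda>x. exp (- x)) t n)"
  by (induction n) (auto simp del: var_seq.simps(3) simp: var_seq_exp_Suc_Suc var_map_def)

lemma has_derivative_var_map:
  "(var_map has_derivative (\<lambda>(a, b). (exp (snd p) * b, exp (snd p) * b - a))) (at p)"
proof -
  have "var_map = (\<lambda>q. (exp (snd q), exp (snd q) - fst q))"
    by (auto simp: var_map_def)
  moreover have "((\<lambda>q. (exp (snd q), exp (snd q) - fst q)) has_derivative
      (\<lambda>(a, b). (exp (snd p) * b, exp (snd p) * b - a))) (at p)" for p :: "real \<times> real"
    by (auto intro!: derivative_eq_intros simp: case_prod_unfold mult.commute)
  ultimately show ?thesis
    by simp
qed

end

theory Submission
  imports Defs
begin

text \<open>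
  Write \<open>x\<^sub>n\<close> for the turning points started at \<open>x\<^sub>1 = t\<close> and \<open>d\<^sub>n\<close> for the derivative of
  \<open>x\<^sub>n\<close> with respect to \<open>t\<close>.  The recursion says that each partial cost
  \<open>\<Sum>k\<le>n. x\<^sub>k\<^sub>+\<^sub>1 exp (- x\<^sub>k)\<close> is stationary in \<open>x\<^sub>1, \<dots>, x\<^sub>n\<close>, so that its derivative in \<open>t\<close> is
  just \<open>d\<^sub>n\<^sub>+\<^sub>1 exp (- x\<^sub>n)\<close> (\<open>has_real_derivative_partial_cost\<close>).  The cost is the limit of
  its partial sums, and so is monotone on an interval on which, from some \<open>n\<close> on, all \<open>d\<^sub>n\<close> have
  one and the same sign.

  The \<open>d\<^sub>n\<close> are the first coordinates of the images of the tangent vector \<open>(1, 1)\<close> under the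
  iterated differential, and satisfy \<open>d\<^sub>n\<^sub>+\<^sub>2 = x\<^sub>n\<^sub>+\<^sub>2 (d\<^sub>n\<^sub>+\<^sub>1 - d\<^sub>n)\<close>.  As soon as the \<open>x\<^sub>n\<close> are at
  least \<open>c\<^sup>2 / (c - 1)\<close>, the cone \<open>d\<^sub>n\<^sub>+\<^sub>1 \<ge> c d\<^sub>n \<ge> 0\<close> is mapped into itself
  (\<open>expanding_recursion_nonneg\<close>).  In the monotone region a lower bound on one turning point
  holds for all later ones, so it suffices to find the vector in such a cone, or in its negative,
  after a few steps.

  For this law the first steps are explicit in \<open>u = exp t\<close>: \<open>x\<^sub>2 = u\<close>, \<open>x\<^sub>3 = exp u / u\<close> and
  \<open>x\<^sub>4 = exp w\<close> with \<open>w = exp u / u - u\<close>.  The monotone part of the initial ray avoids a gap.  If \<open>8/5 \<le> u \<le> 91/50\<close>, the fifth turning point does not exceed the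
  fourth, so that \<open>(t, t)\<close> is not in the monotone region (\<open>initial_ray_gap_not_monotone\<close>).
  Beyond the gap, the vector enters the positive cone at \<open>n = 2\<close> (\<open>turn_deriv_nonneg\<close>) and
  the cost increases.  Below it, \<open>d\<^sub>4 \<le> d\<^sub>3\<close> turns the vector around into the negative cone
  at \<open>n = 5\<close> (\<open>turn_deriv_nonpos\<close>) and the cost decreases.  An interval inside the monotone
  region lies on one side of the gap.
\<close>

section \<open>Numerical bounds for the exponential function\<close>

lemma exp_ge_Taylor_sum:
  fixes x :: real
  assumes "x \<ge> 0"
  shows "(\<Sum>k<n. x ^ k / fact k) \<le> exp x"
proof -
  obtain s where "exp x = (\<Sum>k<n. x ^ k / fact k) + exp s / fact n * x ^ n"
    using Maclaurin_exp_le by blast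
  then show ?thesis using assms by simp
qed

text \<open>The remainder in Lagrange form is at most \<open>exp x\<close> times the next Taylor term; moving it to
  the left turns the Taylor polynomial into an upper bound.\<close>

lemma exp_le_Taylor_sum:
  fixes x :: real
  assumes "x \<ge> 0"
  shows "(1 - x ^ n / fact n) * exp x \<le> (\<Sum>k<n. x ^ k / fact k)"
proof -
  obtain s where s: "\<bar>s\<bar> \<le> \<bar>x\<bar>"
    "exp x = (\<Sum>k<n. x ^ k / fact k) + exp s / fact n * x ^ n"
    using Maclaurin_exp_le by blast
  have "exp s * (x ^ n / fact n) \<le> exp x * (x ^ n / fact n)"
    using s(1) assms by (intro mult_right_mono) auto
  moreover have "exp x = (\<Sum>k<n. x ^ k / fact k) + exp s * (x ^ n / fact n)"
    using s(2) by simp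
  moreover have "(1 - x ^ n / fact n) * exp x = exp x - exp x * (x ^ n / fact n)"
    by (simp only: left_diff_distrib mult_1 mult.commute[of "exp x"])
  ultimately show ?thesis by linarith
qed

text \<open>The arguments \<open>8/5\<close>, \<open>17/10\<close> and \<open>91/50\<close> are the values of \<open>u = exp t\<close> that bound the two
  halves of the gap, and \<open>7/5\<close> and \<open>3/2\<close> serve to estimate the orbits that start below it.\<close>

lemma exp_bounds:
  "exp (7/5 :: real) \<ge> 4"
  "exp (7/5 :: real) \<le> 49/10"
  "exp (3/2 :: real) \<ge> 448/100"
  "exp (8/5 :: real) \<ge> 49/10"
  "exp (8/5 :: real) \<le> 5"
  "exp (17/10 :: real) \<le> 55/10"
  "exp (91/50 :: real) \<ge> 61/10"
  "exp (91/50 :: real) \<le> 618/100"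
proof -
  show "exp (7/5 :: real) \<ge> 4"
    using exp_ge_Taylor_sum[of "7/5" 10] by (simp add: eval_nat_numeral)
  show "exp (7/5 :: real) \<le> 49/10"
    using exp_le_Taylor_sum[of "7/5" 10] by (simp add: eval_nat_numeral)
  show "exp (3/2 :: real) \<ge> 448/100"
    using exp_ge_Taylor_sum[of "3/2" 10] by (simp add: eval_nat_numeral)
  show "exp (8/5 :: real) \<ge> 49/10"
    using exp_ge_Taylor_sum[of "8/5" 10] by (simp add: eval_nat_numeral)
  show "exp (8/5 :: real) \<le> 5"
    using exp_le_Taylor_sum[of "8/5" 10] by (simp add: eval_nat_numeral)
  show "exp (17/10 :: real) \<le> 55/10"
    using exp_le_Taylor_sum[of "17/10" 10] by (simp add: eval_nat_numeral)
  show "exp (91/50 :: real) \<ge> 61/10"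
    using exp_ge_Taylor_sum[of "91/50" 10] by (simp add: eval_nat_numeral)
  show "exp (91/50 :: real) \<le> 618/100"
    using exp_le_Taylor_sum[of "91/50" 10] by (simp add: eval_nat_numeral)
qed

text \<open>These bounds are for the arguments \<open>w\<close> at which the fourth turning point \<open>exp w\<close> is
  estimated.\<close>

lemma exp_bounds':
  "exp (69/40 :: real) \<le> 6"
  "exp (1536/1000 :: real) \<le> 465/100"
  "exp (15757/10000 :: real) \<le> 484/100"
  "exp (153/100 :: real) \<ge> 9/2"
proof -
  show "exp (69/40 :: real) \<le> 6"
    using exp_le_Taylor_sum[of "69/40" 10] by (simp add: eval_nat_numeral)
  show "exp (1536/1000 :: real) \<le> 465/100"
    using exp_le_Taylor_sum[of "1536/1000" 10] by (simp add: eval_nat_numeral)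
  show "exp (15757/10000 :: real) \<le> 484/100"
    using exp_le_Taylor_sum[of "15757/10000" 10] by (simp add: eval_nat_numeral)
  show "exp (153/100 :: real) \<ge> 9/2"
    using exp_ge_Taylor_sum[of "153/100" 10] by (simp add: eval_nat_numeral)
qed

lemma exp_div_self_mono:
  fixes u v :: real
  assumes "1 \<le> u" "u \<le> v"
  shows "exp u / u \<le> exp v / v"
proof -
  have "0 \<le> (u - 1) * (v - u)" using assms by simp
  then have "v \<le> u * (1 + (v - u))" by (simp add: algebra_simps)
  also have "\<dots> \<le> u * exp (v - u)"
    using assms by (intro mult_left_mono exp_ge_add_one_self) auto
  finally have "exp u * v \<le> exp u * (u * exp (v - u))" by simp
  also have "\<dots> = exp v * u" by (simp add: exp_diff)
  finally show ?thesis using assms by (simp add: field_simps)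
qed

text \<open>The derivative of \<open>exp u / u - u\<close> is \<open>exp u (u - 1) / u\<^sup>2 - 1\<close>, where the fraction increases
  for \<open>u \<ge> 1\<close>; once the derivative is nonnegative it stays so.  Comparing \<open>exp (v - u)\<close> with its
  quadratic Taylor polynomial gives this without differentiation.\<close>

lemma exp_div_self_minus_mono:
  fixes u v :: real
  assumes "1 \<le> u" "u \<le> v" and crit: "u\<^sup>2 \<le> exp u * (u - 1)"
  shows "exp u / u - u \<le> exp v / v - v"
proof -
  define h where "h = v - u"
  have h: "v = u + h" "h \<ge> 0" using assms by (auto simp: h_def)
  have "exp u \<ge> 2" using exp_ge_add_one_self[of u] assms by linarith
  then have "2 * (u * h / 2) \<le> exp u * (u * h / 2)"
    using h assms by (intro mult_right_mono) auto
  then have "h * (u\<^sup>2 + u * h) \<le> h * (exp u * (u - 1) + exp u * (u * h / 2))"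
    using h crit by (intro mult_left_mono) auto
  then have "exp u * (u + h) + h * u * (u + h) \<le> u * (exp u * (1 + h + h\<^sup>2 / 2))"
    by (simp add: algebra_simps power2_eq_square)
  also have "\<dots> \<le> u * (exp u * exp h)"
    using h assms by (intro mult_left_mono exp_lower_Taylor_quadratic) auto
  also have "\<dots> = u * exp v" by (simp add: h exp_add)
  finally show ?thesis using h assms by (simp add: field_simps)
qed

section \<open>Derivatives of turning points and of partial costs\<close>

abbreviation turn :: "real \<Rightarrow> nat \<Rightarrow> real" where
  "turn t n \<equiv> var_seq (\<lambda>x. exp (- x)) t n"

declare var_seq.simps(3) [simp del]

fun turn_deriv :: "real \<Rightarrow> nat \<Rightarrow> real" where
  "turn_deriv t 0 = 0"
| "turn_deriv t (Suc 0) = 1"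
| "turn_deriv t (Suc (Suc n)) = turn t (Suc (Suc n)) * (turn_deriv t (Suc n) - turn_deriv t n)"

lemma has_real_derivative_turn:
  "((\<lambda>t. turn t n) has_real_derivative turn_deriv t n) (at t)"
proof (induction t n rule: turn_deriv.induct)
  case (3 t n)
  then show ?case
    by (auto simp: var_seq_exp_Suc_Suc intro!: derivative_eq_intros)
qed auto

definition partial_cost :: "nat \<Rightarrow> real \<Rightarrow> real" where
  "partial_cost N t = (\<Sum>k<N. turn t (Suc k) * exp (- turn t k))"

text \<open>Adding one more term of the series contributes \<open>- x\<^sub>n\<^sub>+\<^sub>1 exp (- x\<^sub>n) d\<^sub>n\<close> to the derivative
  through its factor \<open>exp (- x\<^sub>n)\<close>.  By the recursion this is \<open>- exp (- x\<^sub>n\<^sub>-\<^sub>1) d\<^sub>n\<close>, which cancels the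
  derivative of the preceding partial sum.\<close>

lemma has_real_derivative_partial_cost:
  "(partial_cost (Suc N) has_real_derivative turn_deriv t (Suc N) * exp (- turn t N)) (at t)"
proof (induction N)
  case 0
  show ?case unfolding partial_cost_def by simp
next
  case (Suc N)
  have "((\<lambda>t. turn t (Suc (Suc N)) * exp (- turn t (Suc N))) has_real_derivative
      turn_deriv t (Suc (Suc N)) * exp (- turn t (Suc N))
        - turn t (Suc (Suc N)) * exp (- turn t (Suc N)) * turn_deriv t (Suc N)) (at t)"
    by (rule derivative_eq_intros has_real_derivative_turn refl)+ (simp add: algebra_simps)
  moreover have "turn t (Suc (Suc N)) * exp (- turn t (Suc N)) = exp (- turn t N)"
    by (simp add: var_seq_exp_Suc_Suc flip: exp_add)
  ultimately have "((\<lambda>t. partial_cost (Suc N) t + turn t (Suc (Suc N)) * exp (- turn t (Suc N)))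
      has_real_derivative turn_deriv t (Suc N) * exp (- turn t N)
        + (turn_deriv t (Suc (Suc N)) * exp (- turn t (Suc N))
            - exp (- turn t N) * turn_deriv t (Suc N))) (at t)"
    using DERIV_add[OF Suc.IH] by (simp only:)
  moreover have "partial_cost (Suc (Suc N)) =
      (\<lambda>t. partial_cost (Suc N) t + turn t (Suc (Suc N)) * exp (- turn t (Suc N)))"
    by (simp add: partial_cost_def[abs_def])
  ultimately show ?case by (simp add: mult.commute)
qed

lemma partial_cost_tendsto_cost:
  assumes "t > 0"
  shows "(\<lambda>N. ennreal (partial_cost N t)) \<longlonglongrightarrow> cost (\<lambda>x. exp (- x)) t"
proof -
  have "(\<Sum>k<N. ennreal (turn t (Suc k) * exp (- turn t k))) = ennreal (partial_cost N t)" for N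
    unfolding partial_cost_def
    by (intro sum_ennreal mult_nonneg_nonneg var_seq_exp_nonneg[OF assms]) auto
  then show ?thesis
    using summable_LIMSEQ[of "\<lambda>k. ennreal (turn t (Suc k) * exp (- turn t k))"]
    by (simp add: cost_def)
qed

lemma cost_le_if_turn_deriv_nonneg:
  assumes "0 < s" "s \<le> t"
    and "\<And>r n. s \<le> r \<Longrightarrow> r \<le> t \<Longrightarrow> n \<ge> m \<Longrightarrow> turn_deriv r n \<ge> 0"
  shows "cost (\<lambda>x. exp (- x)) s \<le> cost (\<lambda>x. exp (- x)) t"
proof (rule LIMSEQ_le)
  show "\<exists>M. \<forall>N\<ge>M. ennreal (partial_cost N s) \<le> ennreal (partial_cost N t)"
  proof (intro exI allI impI ennreal_leI)
    fix N assume "N \<ge> Suc m"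
    then obtain n where n: "N = Suc n" "n \<ge> m" by (cases N) auto
    show "partial_cost N s \<le> partial_cost N t"
      unfolding n
      by (rule DERIV_nonneg_imp_nondecreasing[OF assms(2)])
        (use n assms(3) has_real_derivative_partial_cost in fastforce)
  qed
qed (use assms in \<open>auto intro: partial_cost_tendsto_cost\<close>)

lemma cost_ge_if_turn_deriv_nonpos:
  assumes "0 < s" "s \<le> t"
    and "\<And>r n. s \<le> r \<Longrightarrow> r \<le> t \<Longrightarrow> n \<ge> m \<Longrightarrow> turn_deriv r n \<le> 0"
  shows "cost (\<lambda>x. exp (- x)) t \<le> cost (\<lambda>x. exp (- x)) s"
proof (rule LIMSEQ_le)
  show "\<exists>M. \<forall>N\<ge>M. ennreal (partial_cost N t) \<le> ennreal (partial_cost N s)"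
  proof (intro exI allI impI ennreal_leI)
    fix N assume "N \<ge> Suc m"
    then obtain n where n: "N = Suc n" "n \<ge> m" by (cases N) auto
    show "partial_cost N t \<le> partial_cost N s"
      unfolding n
      by (rule DERIV_nonpos_imp_nonincreasing[OF assms(2)])
        (use n assms(3) has_real_derivative_partial_cost in \<open>fastforce simp: mult_le_0_iff\<close>)
  qed
qed (use assms in \<open>auto intro: partial_cost_tendsto_cost\<close>)

section \<open>Propagation of the sign of the derivatives\<close>

text \<open>In terms of the ratio \<open>q = d (Suc n) / d n\<close> the recursion is \<open>q \<mapsto> x (1 - 1/q)\<close>.  This map
  is increasing and sends \<open>c\<close> to \<open>x (c - 1) / c\<close>, so \<open>q \<ge> c\<close> persists while \<open>x\<close> satisfies the bound
  called \<open>large\<close>.\<close>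

lemma expanding_recursion_nonneg:
  fixes x d :: "nat \<Rightarrow> real"
  assumes rec: "\<And>n. d (Suc (Suc n)) = x (Suc (Suc n)) * (d (Suc n) - d n)"
    and "c > 1" and large: "\<And>n. n \<ge> Suc (Suc m) \<Longrightarrow> x n * (c - 1) \<ge> c\<^sup>2"
    and start: "d m \<ge> 0" "d (Suc m) \<ge> c * d m" and "n \<ge> m"
  shows "d n \<ge> 0 \<and> d (Suc n) \<ge> c * d n"
  using \<open>n \<ge> m\<close>
proof (induction n rule: dec_induct)
  case base
  then show ?case using start by simp
next
  case (step n)
  have "c * d n \<ge> 0" using step \<open>c > 1\<close> by simp
  then have pos: "d (Suc n) \<ge> 0" using step by linarith
  have x: "x (Suc (Suc n)) * (c - 1) \<ge> c\<^sup>2" using large step by simp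
  then have "x (Suc (Suc n)) > 0"
    using \<open>c > 1\<close> by (smt (verit) zero_less_power2 zero_less_mult_pos2 mult_nonpos_nonneg)
  moreover have "c * (d (Suc n) - d n) \<ge> (c - 1) * d (Suc n)"
    using step by (simp add: algebra_simps)
  ultimately have "x (Suc (Suc n)) * ((c - 1) * d (Suc n)) \<le> c * d (Suc (Suc n))"
    unfolding rec by (metis mult_le_cancel_left_pos mult.left_commute)
  moreover have "c\<^sup>2 * d (Suc n) \<le> x (Suc (Suc n)) * (c - 1) * d (Suc n)"
    using x pos by (rule mult_right_mono)
  ultimately have "c * (c * d (Suc n)) \<le> c * d (Suc (Suc n))"
    by (simp add: power2_eq_square algebra_simps)
  then show ?case using pos \<open>c > 1\<close> by simp
qed

section \<open>The first turning points and the gap in the initial ray\<close>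

lemma turn_2: "turn t 2 = exp t"
  and turn_3: "turn t 3 = exp (exp t) / exp t"
  and turn_4: "turn t 4 = exp (exp (exp t) / exp t - exp t)"
  and turn_5: "turn t 5 = exp (turn t 4 - turn t 3)"
  by (simp_all add: eval_nat_numeral var_seq_exp_Suc_Suc exp_diff)

lemma turn_deriv_2: "turn_deriv t 2 = exp t"
  and turn_deriv_4: "turn_deriv t 4 = turn t 4 * (turn_deriv t 3 - turn_deriv t 2)"
  and turn_deriv_5: "turn_deriv t 5 = turn t 5 * (turn_deriv t 4 - turn_deriv t 3)"
  and turn_deriv_6: "turn_deriv t 6 = turn t 6 * (turn_deriv t 5 - turn_deriv t 4)"
  by (simp_all add: eval_nat_numeral var_seq_exp_Suc_Suc)

lemma turn_deriv_3: "turn_deriv t 3 = exp (exp t) / exp t * (1 - 1 / exp t) * exp t"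
proof -
  have "turn_deriv t 3 = exp (exp t) / exp t * (exp t - 1)"
    by (simp add: eval_nat_numeral var_seq_exp_Suc_Suc exp_diff)
  also have "exp t - 1 = (1 - 1 / exp t) * exp t" by (simp add: left_diff_distrib)
  finally show ?thesis by simp
qed

lemma monotone_region_initial_ray_mono:
  assumes "(t, t) \<in> monotone_region" "1 \<le> m" "m \<le> n"
  shows "turn t m \<le> turn t n"
proof -
  have "strict_mono (\<lambda>n. turn t (Suc n))"
    using assms(1) by (simp add: monotone_region_def var_map_iterates_initial_ray)
  then have "mono (\<lambda>n. turn t (Suc n))" by (rule strict_mono_mono)
  then show ?thesis using monoD[of _ "m - 1" "n - 1"] assms(2,3) by fastforce
qed

text \<open>With \<open>c = 3/2\<close> the cone is preserved when the turning points are at least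
  \<open>c\<^sup>2 / (c - 1) = 9/2\<close>.  Both \<open>d\<^sub>3 / d\<^sub>2 = exp u (u - 1) / u\<^sup>2\<close> and \<open>x\<^sub>4\<close> increase with \<open>u\<close> here, and
  at \<open>u = 91/50\<close> they are slightly above \<open>3/2\<close> and above \<open>9/2\<close>.\<close>

lemma turn_deriv_nonneg:
  assumes M: "(t, t) \<in> monotone_region" and u: "exp t \<ge> 91/50" and "n \<ge> 2"
  shows "turn_deriv t n \<ge> 0"
proof -
  define u where "u = exp t"
  have u: "u \<ge> 91/50" using u by (simp add: u_def)
  have e: "exp (91/50 :: real) / (91/50) \<le> exp u / u"
    by (rule exp_div_self_mono) (use u in auto)
  have "exp u / u \<ge> 335/100" using e exp_bounds(7) by simp
  moreover have "1 - 1 / u \<ge> 41/91" using u by (simp add: field_simps)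
  ultimately have "335/100 * (41/91) \<le> exp u / u * (1 - 1 / u)"
    using u by (intro mult_mono) auto
  then have "3/2 \<le> exp u / u * (1 - 1 / u)"
    by (rule order_trans[rotated]) simp
  then have grow: "3/2 * u \<le> exp u / u * (1 - 1 / u) * u"
    by (intro mult_right_mono) (use u in auto)
  have d2: "turn_deriv t 2 \<ge> 0" by (simp add: turn_deriv_2)
  from grow have d3: "3/2 * turn_deriv t 2 \<le> turn_deriv t 3"
    by (simp only: turn_deriv_2 turn_deriv_3 flip: u_def)
  have "153/100 \<le> exp (91/50) / (91/50) - (91/50 :: real)"
    using exp_bounds(7) by simp
  also have "\<dots> \<le> exp u / u - u"
    by (rule exp_div_self_minus_mono) (use u exp_bounds(7) in \<open>auto simp: power2_eq_square\<close>)
  finally have "turn t 4 \<ge> exp (153/100)" by (simp add: turn_4 u_def)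
  then have x4: "turn t 4 \<ge> 9/2" using exp_bounds'(4) by linarith
  have "turn_deriv t n \<ge> 0 \<and> turn_deriv t (Suc n) \<ge> 3/2 * turn_deriv t n"
  proof (rule expanding_recursion_nonneg[where m = 2 and x = "turn t" and d = "turn_deriv t"])
    fix k :: nat assume "k \<ge> Suc (Suc 2)"
    then have "turn t 4 \<le> turn t k" by (intro monotone_region_initial_ray_mono[OF M]) auto
    then show "turn t k * (3/2 - 1) \<ge> (3/2)\<^sup>2" using x4 by (simp add: power2_eq_square)
  next
    show "turn_deriv t (Suc 2) \<ge> 3/2 * turn_deriv t 2" using d3 by simp
  qed (use d2 \<open>n \<ge> 2\<close> in simp_all)
  then show ?thesis by simp
qed

text \<open>The bound \<open>4\<close> makes the cone with \<open>c = 2\<close> invariant.  The exponent \<open>w = exp u / u - u\<close> has its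
  minimum, about \<open>1.49\<close>, near \<open>u = 3/2\<close>.  The tangent to \<open>exp\<close> at \<open>3/2\<close> is sharp enough there;
  for smaller \<open>u\<close> the estimate \<open>exp u / u \<ge> exp 1\<close> suffices.\<close>

lemma turn_4_ge:
  assumes "t \<ge> 0" and "exp t \<le> 8/5"
  shows "turn t 4 \<ge> 4"
proof -
  define u where "u = exp t"
  have u: "1 \<le> u" "u \<le> 8/5" using assms by (simp_all add: u_def)
  have "7/5 \<le> exp u / u - u"
  proof (cases "u \<le> 13/10")
    case True
    have "exp (1::real) \<ge> 27/10"
      using exp_ge_Taylor_sum[of 1 6] by (simp add: eval_nat_numeral)
    then show ?thesis using exp_div_self_mono[of 1 u] u True by simp
  next
    case False
    have "448/100 * (u - 1/2) \<le> exp (3/2) * (1 + (u - 3/2))"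
      using mult_right_mono[OF exp_bounds(3), of "u - 1/2"] u by simp
    also have "\<dots> \<le> exp (3/2) * exp (u - 3/2)"
      by (intro mult_left_mono exp_ge_add_one_self) auto
    also have "\<dots> = exp u" by (simp flip: exp_add)
    finally have *: "448/100 * (u - 1/2) \<le> exp u" .
    have "(u - 13/10) * (8/5 - u) \<ge> 0" using False u by simp
    then have "7/5 * u + u\<^sup>2 \<le> 448/100 * (u - 1/2)"
      using u False by (simp add: algebra_simps power2_eq_square)
    then have "7/5 * u + u\<^sup>2 \<le> exp u" using * by simp
    then show ?thesis using u by (simp add: field_simps power2_eq_square)
  qed
  then have "exp (7/5) \<le> turn t 4" by (simp add: turn_4 u_def)
  then show ?thesis using exp_bounds(1) by linarith
qed

text \<open>Put \<open>q = d\<^sub>3 / d\<^sub>2 = exp u (u - 1) / u\<^sup>2\<close>, an increasing function of \<open>u\<close>.  The claim is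
  \<open>x\<^sub>4 (1 - 1/q) \<le> 1\<close>.  Up to \<open>u = 7/5\<close> already \<open>q \<le> 1\<close>; from there to \<open>8/5\<close> one has \<open>q \<le> 6/5\<close> and
  \<open>x\<^sub>4 \<le> 6\<close>.\<close>

lemma turn_deriv_4_le_3:
  assumes "t \<ge> 0" and "exp t \<le> 8/5"
  shows "turn_deriv t 4 \<le> turn_deriv t 3"
proof -
  define u where "u = exp t"
  have u: "1 \<le> u" "u \<le> 8/5" using assms by (simp_all add: u_def)
  have d3: "turn_deriv t 3 = exp u / u * (1 - 1 / u) * u"
    by (simp only: turn_deriv_3 flip: u_def)
  have "turn_deriv t 3 \<ge> 0" using u by (simp add: d3)
  have x4: "turn t 4 \<ge> 0" by (simp add: turn_4)
  show ?thesis
  proof (cases "u \<le> 7/5")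
    case True
    have "exp u / u \<le> 35/10"
      using exp_div_self_mono[of u "7/5"] exp_bounds(2) u True by simp
    moreover have "1 - 1 / u \<le> 2/7" using u True by (simp add: field_simps)
    ultimately have "exp u / u * (1 - 1 / u) \<le> 35/10 * (2/7)"
      using u by (intro mult_mono) auto
    then have "exp u / u * (1 - 1 / u) * u \<le> 1 * u"
      by (intro mult_right_mono) (use u in auto)
    then have "turn_deriv t 3 \<le> turn_deriv t 2"
      by (simp only: d3 turn_deriv_2 u_def[symmetric] mult_1)
    then have "turn_deriv t 4 \<le> 0"
      using x4 by (simp add: turn_deriv_4 mult_le_0_iff)
    then show ?thesis using \<open>turn_deriv t 3 \<ge> 0\<close> by simp
  next
    case False
    have x3: "exp u / u \<le> 25/8"
      using exp_div_self_mono[of u "8/5"] exp_bounds(5) u by simp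
    moreover have "1 - 1 / u \<le> 3/8" using u by (simp add: field_simps)
    ultimately have "exp u / u * (1 - 1 / u) \<le> 25/8 * (3/8)"
      using u by (intro mult_mono) auto
    then have "exp u / u * (1 - 1 / u) * u \<le> 6/5 * u"
      by (intro mult_right_mono) (use u in auto)
    then have "turn_deriv t 3 \<le> 6/5 * turn_deriv t 2"
      by (simp only: d3 turn_deriv_2 u_def[symmetric])
    then have diff: "turn_deriv t 3 - turn_deriv t 2 \<le> turn_deriv t 3 / 6" by simp
    have "exp u / u - u \<le> 69/40" using x3 False by linarith
    then have "turn t 4 \<le> exp (69/40)" by (simp add: turn_4 u_def)
    then have "turn t 4 \<le> 6" using exp_bounds'(1) by linarith
    have "turn_deriv t 4 \<le> turn t 4 * (turn_deriv t 3 / 6)"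
      unfolding turn_deriv_4 using diff x4 by (rule mult_left_mono)
    also have "\<dots> \<le> 6 * (turn_deriv t 3 / 6)"
      using \<open>turn t 4 \<le> 6\<close> \<open>turn_deriv t 3 \<ge> 0\<close> by (intro mult_right_mono) auto
    finally show ?thesis by simp
  qed
qed

text \<open>Although \<open>d\<^sub>1\<close>, \<open>d\<^sub>2\<close> and \<open>d\<^sub>3\<close> are still nonnegative, they grow too slowly to
  enter a positive cone: the difference \<open>d\<^sub>4 - d\<^sub>3\<close> is at most zero, hence so is \<open>d\<^sub>5\<close>.\<close>

lemma turn_deriv_nonpos:
  assumes M: "(t, t) \<in> monotone_region" and t: "t > 0" "exp t \<le> 8/5" and "n \<ge> 5"
  shows "turn_deriv t n \<le> 0"
proof -
  have large: "turn t k \<ge> 4" if "k \<ge> 4" for k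
    using turn_4_ge[of t] monotone_region_initial_ray_mono[OF M, of 4 k] t that by simp
  have d3: "turn_deriv t 3 \<ge> 0" using t by (simp add: turn_deriv_3)
  have d43: "turn_deriv t 4 \<le> turn_deriv t 3" using turn_deriv_4_le_3 t by simp
  have d5: "turn_deriv t 5 \<le> 4 * (turn_deriv t 4 - turn_deriv t 3)"
    unfolding turn_deriv_5 using large[of 5] d43 by (intro mult_right_mono_neg) auto
  \<comment> \<open>If \<open>d\<^sub>4\<close> is negative, then \<open>d\<^sub>5 \<le> 4 (d\<^sub>4 - d\<^sub>3)\<close> dominates it; otherwise \<open>d\<^sub>5 \<le> 0 \<le> d\<^sub>4\<close>.
    In both cases the difference is at most half of \<open>d\<^sub>5\<close>, and the sequence is in the
    negative cone with \<open>c = 2\<close>.\<close>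
  have "turn_deriv t 5 \<le> 0" using d43 d5 by simp
  have "turn_deriv t 5 - turn_deriv t 4 \<le> turn_deriv t 5 / 2"
    using d3 d43 d5 by (simp add: field_simps)
  then have "turn_deriv t 6 \<le> turn t 6 * (turn_deriv t 5 / 2)"
    unfolding turn_deriv_6 using large[of 6] by (intro mult_left_mono) auto
  also have "\<dots> \<le> 4 * (turn_deriv t 5 / 2)"
    using large[of 6] \<open>turn_deriv t 5 \<le> 0\<close> by (intro mult_right_mono_neg) auto
  finally have d6: "2 * - turn_deriv t 5 \<le> - turn_deriv t (Suc 5)" by simp
  have "- turn_deriv t n \<ge> 0 \<and> - turn_deriv t (Suc n) \<ge> 2 * - turn_deriv t n"
  proof (rule expanding_recursion_nonneg[where m = 5 and x = "turn t"
        and d = "\<lambda>n. - turn_deriv t n"])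
    fix k :: nat assume "k \<ge> Suc (Suc 5)"
    then show "turn t k * (2 - 1) \<ge> 2\<^sup>2" using large[of k] by simp
  qed (use d6 \<open>n \<ge> 5\<close> \<open>turn_deriv t 5 \<le> 0\<close> in \<open>simp_all add: algebra_simps\<close>)
  then show ?thesis by simp
qed

text \<open>Since \<open>x\<^sub>4\<close> and \<open>x\<^sub>5\<close> are the exponentials of consecutive step lengths, \<open>x\<^sub>5 \<le> x\<^sub>4\<close> amounts to
  \<open>x\<^sub>4 - x\<^sub>3 \<le> x\<^sub>3 - x\<^sub>2 = w\<close>, that is to \<open>exp w - 2 w \<le> u\<close>.  Both \<open>w\<close> as a function of \<open>u\<close> and the
  left-hand side as a function of \<open>w\<close> increase in this range, so on a short interval of values
  of \<open>u\<close> it is enough to compare the left-hand side at the right end with \<open>u\<close> at the left end.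
  Two such intervals, meeting at \<open>17/10\<close>, cover the gap.\<close>

lemma initial_ray_gap_not_monotone:
  assumes "8/5 \<le> exp t" "exp t \<le> 91/50"
  shows "(t, t) \<notin> monotone_region"
proof
  assume M: "(t, t) \<in> monotone_region"
  have "strict_mono (\<lambda>n. turn t (Suc n))"
    using M by (simp add: monotone_region_def var_map_iterates_initial_ray)
  then have "turn t (Suc 3) < turn t (Suc 4)" by (rule strict_monoD) simp
  then have less: "turn t 4 < turn t 5" by simp
  define u where "u = exp t"
  define w where "w = exp u / u - u"
  have u: "8/5 \<le> u" "u \<le> 91/50" using assms by (simp_all add: u_def)
  have crit: "(8/5)\<^sup>2 \<le> exp (8/5) * (8/5 - 1 :: real)"
    using exp_bounds(4) by (simp add: power2_eq_square)
  have w_le: "w \<le> exp v / v - v" if "u \<le> v" for v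
  proof -
    have "u\<^sup>2 \<le> exp u * (u - 1)"
    proof -
      have "exp (8/5) / (8/5) \<le> exp u / u"
        by (rule exp_div_self_mono) (use u in auto)
      then have "306/100 \<le> exp u / u" using exp_bounds(4) by simp
      moreover have "3/8 \<le> 1 - 1 / u" using u by (simp add: field_simps)
      ultimately have "306/100 * (3/8) \<le> exp u / u * (1 - 1 / u)"
        using u by (intro mult_mono) auto
      then have "1 \<le> exp u / u * (1 - 1 / u)"
        by (rule order_trans[rotated]) simp
      then show ?thesis using u by (simp add: field_simps power2_eq_square)
    qed
    then show ?thesis unfolding w_def using u that by (intro exp_div_self_minus_mono) auto
  qed
  have "exp (8/5) / (8/5) - 8/5 \<le> exp u / u - u"
    by (rule exp_div_self_minus_mono) (use u crit in auto)
  then have w1: "w \<ge> 1" using exp_bounds(4) by (simp add: w_def)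
  have phi: "exp w - 2 * w \<le> exp W - 2 * W" if "w \<le> W" for W
  proof -
    have "exp w \<ge> 2" using exp_ge_add_one_self[of w] w1 by linarith
    then have "2 * (W - w) \<le> exp w * (W - w)" using that by (intro mult_right_mono) auto
    also have "\<dots> \<le> exp w * (exp (W - w) - 1)"
      using exp_ge_add_one_self[of "W - w"] by (intro mult_left_mono) (linarith, simp)
    also have "\<dots> = exp W - exp w" by (simp add: algebra_simps flip: exp_add)
    finally show ?thesis by simp
  qed
  have "exp w - 2 * w \<le> u"
  proof (cases "u \<le> 17/10")
    case True
    have "w \<le> 1536/1000" using w_le[OF True] exp_bounds(6) by simp
    from phi[OF this] show ?thesis using exp_bounds'(2) u by simp
  next
    case False
    have "w \<le> 15757/10000" using w_le[OF u(2)] exp_bounds(8) by simp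
    from phi[OF this] show ?thesis using exp_bounds'(3) False by simp
  qed
  then have "turn t 4 - turn t 3 \<le> exp u / u - u"
    by (simp add: turn_3 turn_4 w_def flip: u_def)
  then have "turn t 5 \<le> turn t 4" by (simp add: turn_5 turn_4 flip: u_def)
  then show False using less by simp
qed

section \<open>Monotonicity of the cost\<close>

theorem proposition10:
  fixes f :: "real \<Rightarrow> real"
    and \<eta> \<xi> :: "real \<times> real \<Rightarrow> real \<times> real"
    and y_minus y_plus :: ereal
    and I :: "real set"
  assumes "f = (\<lambda>x. exp (- x))"
    and "cone_field_on above_separatrix \<eta> \<xi>"
    and "consistent_on above_separatrix var_map \<eta> \<xi>"
    and "\<not> invariant_field_on above_separatrix var_map \<eta>"
    and "I = einterval y_minus y_plus"
    and "I \<subseteq> {0<..}"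
    and "\<forall>t\<in>I. (t, t) \<in> monotone_region"
  shows "mono_on I (cost f) \<or> antimono_on I (cost f)"
proof -
  have interval: "r \<in> I" if "s \<in> I" "t \<in> I" "s \<le> r" "r \<le> t" for r s t
  proof -
    have "y_minus < ereal s" "ereal t < y_plus" using that assms(5) by (auto simp: einterval_iff)
    moreover have "ereal s \<le> ereal r" "ereal r \<le> ereal t" using that by simp_all
    ultimately show ?thesis unfolding assms(5) einterval_iff
      by (blast intro: less_le_trans le_less_trans)
  qed
  have M: "(t, t) \<in> monotone_region" and pos: "t > 0" if "t \<in> I" for t
    using assms(6,7) that by auto
  show ?thesis
  proof (cases "\<exists>t\<in>I. exp t \<le> 8/5")
    case True
    then obtain a where a: "a \<in> I" "exp a \<le> 8/5" by blast
    have left: "exp t \<le> 8/5" if "t \<in> I" for t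
    proof (rule ccontr)
      assume "\<not> exp t \<le> 8/5"
      then have "ln (8/5) \<in> I"
        using interval[OF a(1) that, of "ln (8/5)"] a(2) exp_le_cancel_iff[of "ln (8/5)" t]
        by (simp add: ln_ge_iff)
      then show False using initial_ray_gap_not_monotone[of "ln (8/5)"] M by simp
    qed
    have "antimono_on I (cost f)"
      unfolding assms(1)
    proof (rule monotone_onI)
      fix s t assume st: "s \<in> I" "t \<in> I" "s \<le> t"
      show "cost (\<lambda>x. exp (- x)) t \<le> cost (\<lambda>x. exp (- x)) s"
      proof (rule cost_ge_if_turn_deriv_nonpos[where m = 5])
        fix r n assume "s \<le> r" "r \<le> t" "(n::nat) \<ge> 5"
        moreover from this have "r \<in> I" using interval st by blast
        ultimately show "turn_deriv r n \<le> 0"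
          using turn_deriv_nonpos M pos left by blast
      qed (use st pos in auto)
    qed
    then show ?thesis ..
  next
    case False
    have right: "exp t \<ge> 91/50" if "t \<in> I" for t
      using initial_ray_gap_not_monotone[of t] M[OF that] False that by fastforce
    have "mono_on I (cost f)"
      unfolding assms(1)
    proof (rule monotone_onI)
      fix s t assume st: "s \<in> I" "t \<in> I" "s \<le> t"
      show "cost (\<lambda>x. exp (- x)) s \<le> cost (\<lambda>x. exp (- x)) t"
      proof (rule cost_le_if_turn_deriv_nonneg[where m = 2])
        fix r n assume "s \<le> r" "r \<le> t" "(n::nat) \<ge> 2"
        moreover from this have "r \<in> I" using interval st by blast
        ultimately show "turn_deriv r n \<ge> 0"
          using turn_deriv_nonneg M right by blast
      qed (use st pos in auto)
    qed
    then show ?thesis ..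
  qed
qed

end
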